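(* Consider the generalized Sudoku problem with data $n, \pi_1, \pi_2, \pi_3, i_1, \ldots, i_k, g_{i_1}, \ldots, g_{i_k}$ and solution set $S(n,g)$, and let $x \in S(n, g)$. Then $S(n, g)$ equals the set of all $y \in \mathbb{Z}^{n^2}$ for which there exists a permutation $\tau$ of $\{1, \ldots, n^2\}$ such that $y = \tau(x)$, $\tau$ is $\pi_1$-consistent, $\pi_2$-$x$-consistent and $\pi_3$-$x$-consistent, and $\tau(i_l) = i_l$ for $l = 1, \ldots, k$.
   Context: For $y \in \mathbb{Z}^s$ write $y <> \mathbf{0}$ if every component of $y$ is nonzero. Let $n \ge 2$ and $s(n) = \sum_{i=1}^{n-1} i$. The $s(n) \times n$ matrix $A(n)$ is defined inductively: $A(1)$ is the empty matrix, and $A(m) = \begin{pmatrix} \mathbf{1}_{m-1} & -U_{m-1} \\ \mathbf{0}_{s(m-1)} & A(m-1) \end{pmatrix}$, where $\mathbf{1}_{m-1}$ is the all-ones column, $U_{m-1}$ the identity matrix and $\mathbf{0}_{s(m-1)}$ the zero column of length $s(m-1)$. Let $A$ be the $(n \cdot s(n)) \times n^2$ block-diagonal matrix whose $n$ diagonal blocks all equal $A(n)$. For a permutation $\pi$ of $\{1,\ldots,n^2\}$, $A_\pi$ is the matrix whose $j$-th column is the $\pi^{-1}(j)$-th column of $A$. For a permutation $\tau$ and $x \in \mathbb{Z}^{n^2}$, $\tau(x) = (x_{\tau^{-1}(1)}, \ldots, x_{\tau^{-1}(n^2)})^T$. The constraint sets of $\pi$ are $cs_\pi(j) = \{\pi(i)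 \mid (j-1)n + 1 \le i \le jn\}$, $j=1,\ldots,n$. A permutation $\tau$ is $\pi$-consistent if $\tau(cs_\pi(j)) = cs_\pi(j)$ for all $j$, and $\pi$-$x$-consistent if $\{x_{\tau^{-1}(i)} \mid i \in cs_\pi(j)\} = \{x_i \mid i \in cs_\pi(j)\}$ for all $j$. Generalized Sudoku problem: given permutations $\pi_1, \pi_2, \pi_3$ of $\{1, \ldots, n^2\}$, an integer $0 \le k \le n^2$, an index set $\{i_1, \ldots, i_k\} \subset \{1, \ldots, n^2\}$ and givens $g_{i_l} \in \mathbb{Z}$ with $1 \le g_{i_l} \le n$, its solution set is $S(n,g) = \{x \in \mathbb{Z}^{n^2} \mid 1 \le x_i \le n \ (i = 1,\ldots,n^2),\ A_{\pi_r}x <> \mathbf{0}\ (r = 1,2,3),\ x_{i_l} = g_{i_l}\ (l = 1, \ldots, k)\}$. *)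

theory Defs
  imports "Jordan_Normal_Form.Matrix" "HOL-Combinatorics.Permutations"
begin

text \<open>
  Indices are 0-based, as in the matrix library: the index set of the cells is
  \<open>{0..<n\<^sup>2}\<close> and constraint sets are numbered by \<open>j < n\<close>. Cell values still range
  over \<open>1, \<dots>, n\<close>.
\<close>

definition all_nonzero :: "int vec \<Rightarrow> bool" where
  "all_nonzero y \<longleftrightarrow> (\<forall>i < dim_vec y. y $ i \<noteq> 0)"

definition num_pairs :: "nat \<Rightarrow> nat" where
  "num_pairs n = (\<Sum>i = 1..n - 1. i)"

text \<open>
  The empty matrix \<open>A(1)\<close> is the one with \<open>num_pairs 1 = 0\<close> rows and one column.
  The value at \<open>0\<close> is a dummy.
\<close>

fun diff_mat :: "nat \<Rightarrow> int mat" where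
  "diff_mat 0 = 0\<^sub>m 0 0"
| "diff_mat (Suc 0) = 0\<^sub>m 0 1"
| "diff_mat (Suc (Suc m)) =
     four_block_mat
       (mat (Suc m) 1 (\<lambda>_. 1))          (- 1\<^sub>m (Suc m))
       (0\<^sub>m (num_pairs (Suc m)) 1)        (diff_mat (Suc m))"

definition constraint_mat :: "nat \<Rightarrow> int mat" where
  "constraint_mat n = diag_block_mat (replicate n (diff_mat n))"

text \<open>
  \<open>Hilbert_Choice.inv\<close> is the inverse function; unqualified \<open>inv\<close> would clash with the
  notation for inverses in groups.
\<close>

definition permute_cols :: "(nat \<Rightarrow> nat) \<Rightarrow> int mat \<Rightarrow> int mat" where
  "permute_cols \<pi> M = mat (dim_row M) (dim_col M) (\<lambda>(i, j). M $$ (i, Hilbert_Choice.inv \<pi> j))"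

definition permute_vec :: "(nat \<Rightarrow> nat) \<Rightarrow> int vec \<Rightarrow> int vec" where
  "permute_vec \<tau> x = vec (dim_vec x) (\<lambda>i. x $ Hilbert_Choice.inv \<tau> i)"

definition constraint_set :: "nat \<Rightarrow> (nat \<Rightarrow> nat) \<Rightarrow> nat \<Rightarrow> nat set" where
  "constraint_set n \<pi> j = \<pi> ` {j * n..<(j + 1) * n}"

definition consistent :: "nat \<Rightarrow> (nat \<Rightarrow> nat) \<Rightarrow> (nat \<Rightarrow> nat) \<Rightarrow> bool" where
  "consistent n \<pi> \<tau> \<longleftrightarrow>
     (\<forall>j < n. \<tau> ` constraint_set n \<pi> j = constraint_set n \<pi> j)"

definition vec_consistent ::
    "nat \<Rightarrow> (nat \<Rightarrow> nat) \<Rightarrow> int vec \<Rightarrow> (nat \<Rightarrow> nat) \<Rightarrow> bool" where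
  "vec_consistent n \<pi> x \<tau> \<longleftrightarrow>
     (\<forall>j < n. {x $ Hilbert_Choice.inv \<tau> i | i. i \<in> constraint_set n \<pi> j}
            = {x $ i | i. i \<in> constraint_set n \<pi> j})"

text \<open>
  The givens are presented by the index set \<open>I = {i\<^sub>1, \<dots>, i\<^sub>k}\<close> (so \<open>k = card I\<close>)
  and a function \<open>g\<close>, of which only the values on \<open>I\<close> matter.
\<close>

definition sudoku_solutions ::
    "nat \<Rightarrow> (nat \<Rightarrow> nat) \<Rightarrow> (nat \<Rightarrow> nat) \<Rightarrow> (nat \<Rightarrow> nat) \<Rightarrow> nat set \<Rightarrow> (nat \<Rightarrow> int) \<Rightarrow> int vec set"
where
  "sudoku_solutions n \<pi>\<^sub>1 \<pi>\<^sub>2 \<pi>\<^sub>3 I g =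
     {x \<in> carrier_vec (n\<^sup>2).
        (\<forall>i < n\<^sup>2. 1 \<le> x $ i \<and> x $ i \<le> int n) \<and>
        (\<forall>\<pi> \<in> {\<pi>\<^sub>1, \<pi>\<^sub>2, \<pi>\<^sub>3}. all_nonzero (permute_cols \<pi> (constraint_mat n) *\<^sub>v x)) \<and>
        (\<forall>i \<in> I. x $ i = g i)}"

end

(*
A_\<pi> x <> 0 says that x is injective on each constraint set of \<pi>. As such a set has n elements and
the values lie in {1..n}, this means that x maps each constraint set of \<pi> onto {1..n}. Hence, for
two solutions x and y, both i \<mapsto> (block of i for \<pi>1, x i) and i \<mapsto> (block of i for \<pi>1, y i) are bijections
from the cells onto {0..<n} \<times> {1..n}. The composite of the second with the inverse of the
first is the inverse of the required \<tau>; it fixes every cell at which x and y agree.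
*)
theory Submission imports Defs begin

section \<open>Nonvanishing products as injectivity on constraint sets\<close>

lemma all_nonzero_append:
  "all_nonzero (a @\<^sub>v b) \<longleftrightarrow> all_nonzero a \<and> all_nonzero b"
proof
  assume h: "all_nonzero (a @\<^sub>v b)"
  have "a $ i \<noteq> 0" if "i < dim_vec a" for i
    using h[unfolded all_nonzero_def, rule_format, of i] that by simp
  moreover have "b $ i \<noteq> 0" if "i < dim_vec b" for i
    using h[unfolded all_nonzero_def, rule_format, of "dim_vec a + i"] that by simp
  ultimately show "all_nonzero a \<and> all_nonzero b"
    by (simp add: all_nonzero_def)
qed (auto simp: all_nonzero_def)

lemma num_pairs_Suc: "num_pairs (Suc m) = m + num_pairs m"
  \<comment> \<open>The case \<open>m = 0\<close> stands apart because \<open>n - 1\<close> is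
    truncated in \<open>num_pairs 0\<close>.\<close>
  by (cases m) (simp_all add: num_pairs_def)

lemma diff_mat_carrier: "diff_mat n \<in> carrier_mat (num_pairs n) n"
proof (induction n rule: diff_mat.induct)
  case (3 m)
  have "diff_mat (Suc (Suc m)) \<in> carrier_mat (Suc m + num_pairs (Suc m)) (1 + Suc m)"
    unfolding diff_mat.simps by (rule four_block_carrier_mat) (use 3 in auto)
  then show ?case by (simp only: num_pairs_Suc[of "Suc m"] plus_1_eq_Suc)
qed (auto simp: num_pairs_def)

text \<open>The entries of the product are the differences of entries of \<open>v\<close>, one for
  each pair of distinct positions. In the recursion the top block compares the first entry with all
  later ones, and the bottom block handles the tail.\<close>

lemma all_nonzero_diff_mat:
  assumes "v \<in> carrier_vec n"
  shows "all_nonzero (diff_mat n *\<^sub>v v) \<longleftrightarrow> inj_on (($) v) {..<n}"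
  using assms
proof (induction n arbitrary: v rule: diff_mat.induct)
  case (3 m)
  \<comment> \<open>Head and tail of \<open>v\<close>, matching the column widths \<open>1\<close>
    and \<open>Suc m\<close> of the four blocks.\<close>
  define a where "a = vec 1 (\<lambda>i. v $ i)"
  define d where "d = vec (Suc m) (\<lambda>i. v $ Suc i)"
  have v: "v = a @\<^sub>v d"
    using "3.prems" by (intro eq_vecI) (auto simp: a_def d_def)
  have [simp]: "a \<in> carrier_vec 1" "d \<in> carrier_vec (Suc m)"
    by (auto simp: a_def d_def)
  let ?top = "mat (Suc m) 1 (\<lambda>_. 1) *\<^sub>v a + (- 1\<^sub>m (Suc m)) *\<^sub>v d"
  let ?bot = "0\<^sub>m (num_pairs (Suc m)) 1 *\<^sub>v a + diff_mat (Suc m) *\<^sub>v d"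
  have prod: "diff_mat (Suc (Suc m)) *\<^sub>v v = ?top @\<^sub>v ?bot"
    unfolding v diff_mat.simps
    by (rule four_block_mat_mult_vec)
      (use diff_mat_carrier[of "Suc m"] in \<open>auto simp del: One_nat_def\<close>)
  have "?top = vec (Suc m) (\<lambda>i. v $ 0 - v $ Suc i)"
    by (intro eq_vecI; simp add: a_def d_def; simp add: scalar_prod_def)
  then have top: "all_nonzero ?top \<longleftrightarrow> (\<forall>i < Suc m. v $ 0 \<noteq> v $ Suc i)"
    by (simp add: all_nonzero_def)
  have "?bot = diff_mat (Suc m) *\<^sub>v d"
    using diff_mat_carrier[of "Suc m"] by (intro eq_vecI) (auto simp del: One_nat_def)
  then have bot: "all_nonzero ?bot \<longleftrightarrow> inj_on (($) d) {..<Suc m}"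
    using "3.IH"[of d] by simp
  \<comment> \<open>Moving the tail back to its positions in \<open>v\<close> leaves index 0 to be
    inserted; \<open>inj_on_insert\<close> then asks for exactly the inequalities given by
    \<open>top\<close>.\<close>
  have "inj_on (($) d) {..<Suc m} \<longleftrightarrow> inj_on (($) v) (Suc ` {..<Suc m})"
    by (auto simp: inj_on_def d_def)
  then show ?case
    unfolding prod all_nonzero_append top bot lessThan_Suc_eq_insert_0[of "Suc m"] inj_on_insert
    by auto
\<comment> \<open>For sizes 0 and 1 the matrix has no rows and there is at most one index, so both
  sides hold trivially.\<close>
qed (auto simp: all_nonzero_def inj_on_def)

text \<open>Each copy of \<open>B\<close> sees only its own slice of \<open>v\<close>, of length
  \<open>c\<close>. The induction splits off the first block; the zero blocks beside the diagonal
  contribute nothing.\<close>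

lemma all_nonzero_diag_block_replicate:
  assumes B: "B \<in> carrier_mat r c" and "v \<in> carrier_vec (k * c)"
  shows "all_nonzero (diag_block_mat (replicate k B) *\<^sub>v v) \<longleftrightarrow>
    (\<forall>j < k. all_nonzero (B *\<^sub>v vec c (\<lambda>i. v $ (j * c + i))))"
  using assms(2)
proof (induction k arbitrary: v)
  case 0
  then show ?case by (simp add: all_nonzero_def)
next
  case (Suc k)
  let ?D = "diag_block_mat (replicate k B)"
  define a where "a = vec c (\<lambda>i. v $ i)"
  define d where "d = vec (k * c) (\<lambda>i. v $ (c + i))"
  have v: "v = a @\<^sub>v d"
    using Suc.prems by (intro eq_vecI) (auto simp: a_def d_def)
  have [simp]: "a \<in> carrier_vec c" "d \<in> carrier_vec (k * c)"
    by (auto simp: a_def d_def)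
  have D: "?D \<in> carrier_mat (k * r) (k * c)"
    using B by (auto simp: dim_diag_block_mat sum_list_replicate)
  have "diag_block_mat (replicate (Suc k) B) *\<^sub>v v =
      (B *\<^sub>v a + 0\<^sub>m r (k * c) *\<^sub>v d) @\<^sub>v (0\<^sub>m (k * r) c *\<^sub>v a + ?D *\<^sub>v d)"
    unfolding v using B D
    by (simp add: Let_def four_block_mat_mult_vec[OF B _ _ D])
  also have "B *\<^sub>v a + 0\<^sub>m r (k * c) *\<^sub>v d = B *\<^sub>v a"
    using B by (intro eq_vecI) auto
  also have "0\<^sub>m (k * r) c *\<^sub>v a + ?D *\<^sub>v d = ?D *\<^sub>v d"
    using D by (intro eq_vecI) auto
  finally have prod: "diag_block_mat (replicate (Suc k) B) *\<^sub>v v = B *\<^sub>v a @\<^sub>v ?D *\<^sub>v d" .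
  have slice: "vec c (\<lambda>i. d $ (j * c + i)) = vec c (\<lambda>i. v $ (Suc j * c + i))" if "j < k" for j
  proof (rule eq_vecI)
    fix i assume i: "i < dim_vec (vec c (\<lambda>i. v $ (Suc j * c + i)))"
    \<comment> \<open>This bound keeps the index \<open>j * c + i\<close> inside the tail
      \<open>d\<close>, whose entries are known only below \<open>k * c\<close>.\<close>
    have "j * c + c \<le> k * c"
      using that mult_le_mono1[of "Suc j" k c] by simp
    with i show "vec c (\<lambda>i. d $ (j * c + i)) $ i = vec c (\<lambda>i. v $ (Suc j * c + i)) $ i"
      by (simp add: d_def ac_simps)
  qed simp
  show ?case
    unfolding prod all_nonzero_append All_less_Suc2 Suc.IH[OF \<open>d \<in> carrier_vec (k * c)\<close>]
    by (simp add: slice a_def del: mult_Suc)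
qed

text \<open>Reindexing the row sums along \<open>\<pi>\<close> moves the permutation from the
  columns to the vector, so that the block-diagonal shape of the matrix can be used.\<close>

lemma permute_cols_mult_vec:
  assumes "\<pi> permutes {0..<m}" "M \<in> carrier_mat r m" "x \<in> carrier_vec m"
  shows "permute_cols \<pi> M *\<^sub>v x = M *\<^sub>v vec m (\<lambda>i. x $ \<pi> i)"
proof (rule eq_vecI)
  fix i assume "i < dim_vec (M *\<^sub>v vec m (\<lambda>i. x $ \<pi> i))"
  then have i: "i < r" using assms by simp
  have "(\<Sum>j = 0..<m. M $$ (i, Hilbert_Choice.inv \<pi> j) * x $ j) =
      (\<Sum>j = 0..<m. M $$ (i, j) * x $ \<pi> j)"
    by (subst sum.permute[OF assms(1)]) (simp add: permutes_inverses[OF assms(1)])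
  then show "(permute_cols \<pi> M *\<^sub>v x) $ i = (M *\<^sub>v vec m (\<lambda>i. x $ \<pi> i)) $ i"
    using i assms by (simp add: permute_cols_def scalar_prod_def)
qed (use assms in \<open>auto simp: permute_cols_def\<close>)

lemma constraint_mat_carrier: "constraint_mat n \<in> carrier_mat (n * num_pairs n) (n\<^sup>2)"
  using diff_mat_carrier[of n]
  by (auto simp: constraint_mat_def dim_diag_block_mat sum_list_replicate power2_eq_square)

lemma all_nonzero_constraint_mat:
  assumes \<pi>: "\<pi> permutes {0..<n\<^sup>2}" and x: "x \<in> carrier_vec (n\<^sup>2)"
  shows "all_nonzero (permute_cols \<pi> (constraint_mat n) *\<^sub>v x) \<longleftrightarrow>
    (\<forall>j < n. inj_on (($) x) (constraint_set n \<pi> j))"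
proof -
  \<comment> \<open>The \<open>j\<close>-th slice of \<open>w\<close> of length \<open>n\<close>
    lists the values of \<open>x\<close> on \<open>constraint_set n \<pi> j\<close>; injectivity is
    carried over along the shift by \<open>j * n\<close> and then along
    \<open>\<pi>\<close>.\<close>
  define w where "w = vec (n\<^sup>2) (\<lambda>i. x $ \<pi> i)"
  have "inj_on (($) (vec n (\<lambda>i. w $ (j * n + i)))) {..<n} \<longleftrightarrow>
      inj_on (($) x) (constraint_set n \<pi> j)" if "j < n" for j
  proof -
    have "j * n + n \<le> n\<^sup>2"
      using that mult_le_mono1[of "Suc j" n n] by (simp add: power2_eq_square)
    then have "inj_on (($) (vec n (\<lambda>i. w $ (j * n + i)))) {..<n} \<longleftrightarrow>
        inj_on ((\<lambda>i. x $ \<pi> i) \<circ> (+) (j * n)) {0..<n}"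
      unfolding atLeast0LessThan by (intro inj_on_cong) (simp add: w_def)
    also have "\<dots> \<longleftrightarrow> inj_on (\<lambda>i. x $ \<pi> i) {j * n..<(j + 1) * n}"
      using comp_inj_on_iff[of "(+) (j * n)" "{0..<n}" "\<lambda>i. x $ \<pi> i"]
      by (simp add: algebra_simps)
    also have "\<dots> \<longleftrightarrow> inj_on (($) x) (constraint_set n \<pi> j)"
      unfolding constraint_set_def
      using comp_inj_on_iff[of \<pi> "{j * n..<(j + 1) * n}" "($) x"] permutes_inj_on[OF \<pi>]
      by (simp add: comp_def)
    finally show ?thesis .
  qed
  moreover have "permute_cols \<pi> (constraint_mat n) *\<^sub>v x =
      diag_block_mat (replicate n (diff_mat n)) *\<^sub>v w"
    unfolding w_def constraint_mat_def[symmetric]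
    by (rule permute_cols_mult_vec[OF \<pi> constraint_mat_carrier x])
  moreover have "w \<in> carrier_vec (n * n)"
    by (simp add: w_def power2_eq_square)
  ultimately show ?thesis
    by (simp add: all_nonzero_diag_block_replicate[OF diff_mat_carrier] all_nonzero_diff_mat)
qed

section \<open>Constraint sets and the values taken on them\<close>

lemma card_constraint_set:
  assumes "\<pi> permutes {0..<n\<^sup>2}"
  shows "card (constraint_set n \<pi> j) = n"
  unfolding constraint_set_def using permutes_inj_on[OF assms]
  by (simp add: card_image)

text \<open>The numbers in the \<open>j\<close>-th interval are those with quotient \<open>j\<close>
  by \<open>n\<close>. This makes \<open>Hilbert_Choice.inv \<pi> i div n\<close> the block number
  of cell \<open>i\<close>, the first coordinate of the later bijections.\<close>

lemma constraint_set_eq: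
  assumes \<pi>: "\<pi> permutes {0..<n\<^sup>2}" and "j < n"
  shows "constraint_set n \<pi> j = {i. i < n\<^sup>2 \<and> Hilbert_Choice.inv \<pi> i div n = j}"
proof -
  have "k \<in> {j * n..<(j + 1) * n} \<longleftrightarrow> k < n\<^sup>2 \<and> k div n = j" for k
  proof -
    have "j * n + n \<le> n\<^sup>2"
      using \<open>j < n\<close> mult_le_mono1[of "Suc j" n n] by (simp add: power2_eq_square)
    then show ?thesis
      using \<open>j < n\<close> by (auto simp: div_nat_eqI dividend_less_times_div mult.commute)
  qed
  then have "i \<in> constraint_set n \<pi> j \<longleftrightarrow>
      Hilbert_Choice.inv \<pi> i < n\<^sup>2 \<and> Hilbert_Choice.inv \<pi> i div n = j" for i
    unfolding constraint_set_def
    by (metis (no_types, lifting) imageE imageI permutes_inverses[OF \<pi>])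
  moreover have "Hilbert_Choice.inv \<pi> i < n\<^sup>2 \<longleftrightarrow> i < n\<^sup>2" for i
    using permutes_in_image[OF permutes_inv[OF \<pi>], of i] by simp
  ultimately show ?thesis by auto
qed

lemma inj_on_constraint_set_iff:
  fixes x :: "int vec"
  assumes \<pi>: "\<pi> permutes {0..<n\<^sup>2}" and "j < n"
    and range: "\<forall>i < n\<^sup>2. 1 \<le> x $ i \<and> x $ i \<le> int n"
  shows "inj_on (($) x) (constraint_set n \<pi> j) \<longleftrightarrow> ($) x ` constraint_set n \<pi> j = {1..int n}"
proof -
  have sub: "($) x ` constraint_set n \<pi> j \<subseteq> {1..int n}"
    using range by (auto simp: constraint_set_eq[OF \<pi> \<open>j < n\<close>])
  have fin: "finite (constraint_set n \<pi> j)"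
    by (simp add: constraint_set_def)
  show ?thesis
  proof
    assume "inj_on (($) x) (constraint_set n \<pi> j)"
    then show "($) x ` constraint_set n \<pi> j = {1..int n}"
      using sub by (intro card_subset_eq) (simp_all add: card_image card_constraint_set[OF \<pi>])
  next
    assume "($) x ` constraint_set n \<pi> j = {1..int n}"
    then show "inj_on (($) x) (constraint_set n \<pi> j)"
      using fin by (intro eq_card_imp_inj_on) (simp_all add: card_constraint_set[OF \<pi>])
  qed
qed

text \<open>Surjectivity is the convenient form of the constraints: it depends only on the set of
  values in a block, which is what \<open>vec_consistent\<close> compares.\<close>

lemma sudoku_solutions_iff:
  assumes "\<pi>\<^sub>1 permutes {0..<n\<^sup>2}" "\<pi>\<^sub>2 permutes {0..<n\<^sup>2}" "\<pi>\<^sub>3 permutes {0..<n\<^sup>2}"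
  shows "x \<in> sudoku_solutions n \<pi>\<^sub>1 \<pi>\<^sub>2 \<pi>\<^sub>3 I g \<longleftrightarrow>
    x \<in> carrier_vec (n\<^sup>2) \<and> (\<forall>i < n\<^sup>2. 1 \<le> x $ i \<and> x $ i \<le> int n) \<and>
    (\<forall>\<pi> \<in> {\<pi>\<^sub>1, \<pi>\<^sub>2, \<pi>\<^sub>3}. \<forall>j < n. ($) x ` constraint_set n \<pi> j = {1..int n}) \<and>
    (\<forall>i \<in> I. x $ i = g i)"
proof -
  have "all_nonzero (permute_cols \<pi> (constraint_mat n) *\<^sub>v x) \<longleftrightarrow>
      (\<forall>j < n. ($) x ` constraint_set n \<pi> j = {1..int n})"
    if "x \<in> carrier_vec (n\<^sup>2)" "\<forall>i < n\<^sup>2. 1 \<le> x $ i \<and> x $ i \<le> int n" "\<pi> \<in> {\<pi>\<^sub>1, \<pi>\<^sub>2, \<pi>\<^sub>3}" for \<pi>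
  proof -
    have "\<pi> permutes {0..<n\<^sup>2}"
      using that(3) assms by auto
    then show ?thesis
      using inj_on_constraint_set_iff[OF _ _ that(2)] all_nonzero_constraint_mat[OF _ that(1)]
      by simp
  qed
  then show ?thesis
    \<comment> \<open>\<open>conj_cong\<close> supplies the dimension and range conditions while the
      third conjunct is being replaced.\<close>
    unfolding sudoku_solutions_def mem_Collect_eq by (intro conj_cong ball_cong refl)
qed

text \<open>Every value occurs in every block, so the map is onto; domain and target both have n^2
  elements, so it is also injective.\<close>

lemma bij_betw_block_value:
  fixes x :: "int vec"
  assumes \<pi>: "\<pi> permutes {0..<n\<^sup>2}"
    and range: "\<forall>i < n\<^sup>2. 1 \<le> x $ i \<and> x $ i \<le> int n"
    and onto: "\<forall>j < n. ($) x ` constraint_set n \<pi> j = {1..int n}"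
  shows "bij_betw (\<lambda>i. (Hilbert_Choice.inv \<pi> i div n, x $ i)) {0..<n\<^sup>2} ({0..<n} \<times> {1..int n})"
proof -
  let ?f = "\<lambda>i. (Hilbert_Choice.inv \<pi> i div n, x $ i)"
  have "Hilbert_Choice.inv \<pi> i div n < n" if "i < n\<^sup>2" for i
    using permutes_in_image[OF permutes_inv[OF \<pi>], of i] that
    by (simp add: less_mult_imp_div_less power2_eq_square)
  then have "?f ` {0..<n\<^sup>2} \<subseteq> {0..<n} \<times> {1..int n}"
    using range by auto
  moreover have "{0..<n} \<times> {1..int n} \<subseteq> ?f ` {0..<n\<^sup>2}"
  proof
    fix p assume "p \<in> {0..<n} \<times> {1..int n}"
    then obtain j k where p: "p = (j, k)" "j < n" "k \<in> {1..int n}" by auto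
    then obtain i where "i \<in> constraint_set n \<pi> j" "x $ i = k"
      using onto by (metis imageE)
    then show "p \<in> ?f ` {0..<n\<^sup>2}"
      using p by (auto simp: constraint_set_eq[OF \<pi> \<open>j < n\<close>])
  qed
  ultimately have "?f ` {0..<n\<^sup>2} = {0..<n} \<times> {1..int n}" ..
  moreover from this have "inj_on ?f {0..<n\<^sup>2}"
    by (intro eq_card_imp_inj_on) (simp_all add: card_cartesian_product power2_eq_square)
  ultimately show ?thesis
    by (simp add: bij_betw_def)
qed

text \<open>Identifies one side of the equation in \<open>vec_consistent\<close> with the set of
  values of the permuted vector on \<open>C\<close>.\<close>

lemma permute_vec_image:
  assumes "\<And>i. i \<in> C \<Longrightarrow> i < dim_vec x"
  shows "($) (permute_vec \<tau> x) ` C = {x $ Hilbert_Choice.inv \<tau> i | i. i \<in> C}"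
proof -
  have "($) (permute_vec \<tau> x) ` C = (\<lambda>i. x $ Hilbert_Choice.inv \<tau> i) ` C"
    by (intro image_cong refl) (simp add: permute_vec_def assms)
  then show ?thesis
    by (simp add: setcompr_eq_image)
qed

section \<open>Solutions as consistent rearrangements of a given solution\<close>

theorem theorem4p2:
  fixes n :: nat and \<pi>\<^sub>1 \<pi>\<^sub>2 \<pi>\<^sub>3 :: "nat \<Rightarrow> nat"
    and I :: "nat set" and g :: "nat \<Rightarrow> int" and x :: "int vec"
  assumes "n \<ge> 2"
    and "\<pi>\<^sub>1 permutes {0..<n\<^sup>2}" and "\<pi>\<^sub>2 permutes {0..<n\<^sup>2}" and "\<pi>\<^sub>3 permutes {0..<n\<^sup>2}"
    and "I \<subseteq> {0..<n\<^sup>2}" and "\<forall>i \<in> I. 1 \<le> g i \<and> g i \<le> int n"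
    and "x \<in> sudoku_solutions n \<pi>\<^sub>1 \<pi>\<^sub>2 \<pi>\<^sub>3 I g"
  shows "sudoku_solutions n \<pi>\<^sub>1 \<pi>\<^sub>2 \<pi>\<^sub>3 I g =
    {y \<in> carrier_vec (n\<^sup>2). \<exists>\<tau>. \<tau> permutes {0..<n\<^sup>2} \<and> y = permute_vec \<tau> x \<and>
       consistent n \<pi>\<^sub>1 \<tau> \<and> vec_consistent n \<pi>\<^sub>2 x \<tau> \<and> vec_consistent n \<pi>\<^sub>3 x \<tau> \<and>
       (\<forall>i \<in> I. \<tau> i = i)}"
proof -
  note perms = assms(2-4)
  have x: "x \<in> carrier_vec (n\<^sup>2)" "\<forall>i < n\<^sup>2. 1 \<le> x $ i \<and> x $ i \<le> int n"
    and x_onto: "\<And>\<pi> j. \<pi> \<in> {\<pi>\<^sub>1, \<pi>\<^sub>2, \<pi>\<^sub>3} \<Longrightarrow> j < n \<Longrightarrow> ($) x ` constraint_set n \<pi> j = {1..int n}"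
    and x_givens: "\<forall>i \<in> I. x $ i = g i"
    using assms(7) unfolding sudoku_solutions_iff[OF perms] by blast+
  have lt: "i < n\<^sup>2" if "\<pi> \<in> {\<pi>\<^sub>1, \<pi>\<^sub>2, \<pi>\<^sub>3}" "j < n" "i \<in> constraint_set n \<pi> j" for \<pi> i j
    using that perms constraint_set_eq[of \<pi> n j] by auto
  have image: "($) (permute_vec \<tau> x) ` constraint_set n \<pi> j =
      {x $ Hilbert_Choice.inv \<tau> i | i. i \<in> constraint_set n \<pi> j}"
    if "\<pi> \<in> {\<pi>\<^sub>1, \<pi>\<^sub>2, \<pi>\<^sub>3}" "j < n" for \<tau> \<pi> j
    by (rule permute_vec_image) (use lt[OF that] x(1) in auto)
  show ?thesis
  proof (intro equalityI subsetI)
    fix y assume "y \<in> sudoku_solutions n \<pi>\<^sub>1 \<pi>\<^sub>2 \<pi>\<^sub>3 I g"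
    then have y: "y \<in> carrier_vec (n\<^sup>2)" "\<forall>i < n\<^sup>2. 1 \<le> y $ i \<and> y $ i \<le> int n"
      and y_onto: "\<And>\<pi> j. \<pi> \<in> {\<pi>\<^sub>1, \<pi>\<^sub>2, \<pi>\<^sub>3} \<Longrightarrow> j < n \<Longrightarrow> ($) y ` constraint_set n \<pi> j = {1..int n}"
      and y_givens: "\<forall>i \<in> I. y $ i = g i"
      unfolding sudoku_solutions_iff[OF perms] by blast+
    let ?S = "{0..<n\<^sup>2}"
    define X where "X = (\<lambda>i. (Hilbert_Choice.inv \<pi>\<^sub>1 i div n, x $ i))"
    define Y where "Y = (\<lambda>i. (Hilbert_Choice.inv \<pi>\<^sub>1 i div n, y $ i))"
    have X: "bij_betw X ?S ({0..<n} \<times> {1..int n})"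
      unfolding X_def using bij_betw_block_value[OF perms(1) x(2)] x_onto by blast
    have Y: "bij_betw Y ?S ({0..<n} \<times> {1..int n})"
      unfolding Y_def using bij_betw_block_value[OF perms(1) y(2)] y_onto by blast
    \<comment> \<open>\<open>\<sigma> i\<close> is the cell in the
      \<open>\<pi>\<^sub>1\<close>-block of \<open>i\<close> where \<open>x\<close> takes the value
      \<open>y $ i\<close>. It is to be the inverse of \<open>\<tau>\<close>, as
      \<open>permute_vec\<close> reads \<open>x\<close> at the inverse; \<open>permutes\<close>
      demands the identity outside \<open>?S\<close>.\<close>
    define \<sigma> where "\<sigma> = (\<lambda>i. if i \<in> ?S then inv_into ?S X (Y i) else i)"
    have bij: "bij_betw \<sigma> ?S ?S"
      using bij_betw_trans[OF Y bij_betw_inv_into[OF X]]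
      by (rule iffD1[OF bij_betw_cong, rotated]) (simp add: \<sigma>_def)
    then have \<sigma>: "\<sigma> permutes ?S"
      by (rule bij_imp_permutes) (simp add: \<sigma>_def)
    \<comment> \<open>The second coordinate yields \<open>y = permute_vec \<tau> x\<close>, the
      first that \<open>\<sigma>\<close> preserves the blocks of
      \<open>\<pi>\<^sub>1\<close>.\<close>
    have X_\<sigma>: "X (\<sigma> i) = Y i" if "i < n\<^sup>2" for i
      using that bij_betw_inv_into_right[OF X] bij_betwE[OF Y] by (simp add: \<sigma>_def)
    have \<sigma>_fix: "\<sigma> i = i" if "i \<in> I" for i
    proof -
      have "i \<in> ?S" "Y i = X i"
        using that assms(5) x_givens y_givens by (auto simp: X_def Y_def)
      then show ?thesis
        using bij_betw_inv_into_left[OF X] by (simp add: \<sigma>_def)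
    qed
    define \<tau> where "\<tau> = Hilbert_Choice.inv \<sigma>"
    have \<tau>: "\<tau> permutes ?S"
      unfolding \<tau>_def by (rule permutes_inv[OF \<sigma>])
    have inv_\<tau>: "Hilbert_Choice.inv \<tau> = \<sigma>"
      unfolding \<tau>_def by (rule permutes_inv_inv[OF \<sigma>])
    have y_eq: "y = permute_vec \<tau> x"
      using x(1) y(1) X_\<sigma> by (intro eq_vecI) (auto simp: permute_vec_def inv_\<tau> X_def Y_def)
    have "\<tau> ` constraint_set n \<pi>\<^sub>1 j = constraint_set n \<pi>\<^sub>1 j" if "j < n" for j
    proof -
      let ?C = "constraint_set n \<pi>\<^sub>1 j"
      have "\<sigma> i < n\<^sup>2" if "i < n\<^sup>2" for i
        using permutes_in_image[OF \<sigma>, of i] that by simp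
      then have "\<sigma> ` ?C \<subseteq> ?C"
        using X_\<sigma> by (auto simp: constraint_set_eq[OF perms(1) \<open>j < n\<close>] X_def Y_def)
      \<comment> \<open>An injective map of a finite set into itself is onto.\<close>
      then have "\<sigma> ` ?C = ?C"
        by (rule endo_inj_surj[rotated]) (auto simp: constraint_set_def permutes_inj_on[OF \<sigma>])
      then have "\<tau> ` ?C = \<tau> ` \<sigma> ` ?C" by simp
      also have "\<dots> = ?C"
        by (simp add: \<tau>_def image_image permutes_inverses[OF \<sigma>])
      finally show ?thesis .
    qed
    then have "consistent n \<pi>\<^sub>1 \<tau>"
      by (simp add: consistent_def)
    \<comment> \<open>Both \<open>x\<close> and its rearrangement \<open>y\<close> have value set
      \<open>{1..int n}\<close> on each constraint set.\<close>
    moreover have "vec_consistent n \<pi> x \<tau>" if "\<pi> \<in> {\<pi>\<^sub>1, \<pi>\<^sub>2, \<pi>\<^sub>3}" for \<pi>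
      unfolding vec_consistent_def
      using image[OF that, of _ \<tau>] x_onto[OF that] y_onto[OF that]
      by (simp add: y_eq[symmetric] setcompr_eq_image)
    moreover have "\<tau> i = i" if "i \<in> I" for i
      using \<sigma>_fix[OF that] permutes_inverses(2)[OF \<sigma>, of i] by (simp add: \<tau>_def)
    ultimately show "y \<in> {y \<in> carrier_vec (n\<^sup>2). \<exists>\<tau>. \<tau> permutes ?S \<and> y = permute_vec \<tau> x \<and>
       consistent n \<pi>\<^sub>1 \<tau> \<and> vec_consistent n \<pi>\<^sub>2 x \<tau> \<and> vec_consistent n \<pi>\<^sub>3 x \<tau> \<and>
       (\<forall>i \<in> I. \<tau> i = i)}"
      using y(1) \<tau> y_eq by blast
  next
    fix y
    assume "y \<in> {y \<in> carrier_vec (n\<^sup>2). \<exists>\<tau>. \<tau> permutes {0..<n\<^sup>2} \<and> y = permute_vec \<tau> x \<and>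
       consistent n \<pi>\<^sub>1 \<tau> \<and> vec_consistent n \<pi>\<^sub>2 x \<tau> \<and> vec_consistent n \<pi>\<^sub>3 x \<tau> \<and>
       (\<forall>i \<in> I. \<tau> i = i)}"
    then obtain \<tau> where y: "y \<in> carrier_vec (n\<^sup>2)" and \<tau>: "\<tau> permutes {0..<n\<^sup>2}"
      and y_eq: "y = permute_vec \<tau> x" and c1: "consistent n \<pi>\<^sub>1 \<tau>"
      and c23: "vec_consistent n \<pi>\<^sub>2 x \<tau>" "vec_consistent n \<pi>\<^sub>3 x \<tau>" and fixed: "\<forall>i \<in> I. \<tau> i = i"
      by blast
    have y_nth: "y $ i = x $ Hilbert_Choice.inv \<tau> i" if "i < n\<^sup>2" for i
      using that x(1) by (simp add: y_eq permute_vec_def)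
    have inv_lt: "Hilbert_Choice.inv \<tau> i < n\<^sup>2" if "i < n\<^sup>2" for i
      using permutes_in_image[OF permutes_inv[OF \<tau>], of i] that by simp
    \<comment> \<open>With \<open>\<tau>\<close> its inverse also preserves the blocks of
      \<open>\<pi>\<^sub>1\<close>, hence the values of \<open>x\<close> on them. The three
      permutations can then be treated alike.\<close>
    have "vec_consistent n \<pi>\<^sub>1 x \<tau>"
      unfolding vec_consistent_def
    proof (intro allI impI)
      fix j assume "j < n"
      then have "\<tau> ` constraint_set n \<pi>\<^sub>1 j = constraint_set n \<pi>\<^sub>1 j"
        using c1 by (simp add: consistent_def)
      then have "Hilbert_Choice.inv \<tau> ` constraint_set n \<pi>\<^sub>1 j =
          Hilbert_Choice.inv \<tau> ` \<tau> ` constraint_set n \<pi>\<^sub>1 j" by simp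
      also have "\<dots> = constraint_set n \<pi>\<^sub>1 j"
        by (simp add: image_image permutes_inverses[OF \<tau>])
      finally have "($) x ` Hilbert_Choice.inv \<tau> ` constraint_set n \<pi>\<^sub>1 j =
          ($) x ` constraint_set n \<pi>\<^sub>1 j" by simp
      then show "{x $ Hilbert_Choice.inv \<tau> i | i. i \<in> constraint_set n \<pi>\<^sub>1 j} =
          {x $ i | i. i \<in> constraint_set n \<pi>\<^sub>1 j}"
        by (simp add: image_image setcompr_eq_image)
    qed
    then have "vec_consistent n \<pi> x \<tau>" if "\<pi> \<in> {\<pi>\<^sub>1, \<pi>\<^sub>2, \<pi>\<^sub>3}" for \<pi>
      using that c23 by auto
    \<comment> \<open>Value consistency says that \<open>y\<close> has the same value set as
      \<open>x\<close> on the block, and \<open>x\<close> is onto there.\<close>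
    then have "($) y ` constraint_set n \<pi> j = {1..int n}" if "\<pi> \<in> {\<pi>\<^sub>1, \<pi>\<^sub>2, \<pi>\<^sub>3}" "j < n" for \<pi> j
      using that image[OF that, of \<tau>] x_onto[OF that]
      by (simp add: y_eq vec_consistent_def setcompr_eq_image)
    moreover have "y $ i = g i" if "i \<in> I" for i
    proof -
      have "Hilbert_Choice.inv \<tau> i = i"
        using fixed that permutes_inverses(2)[OF \<tau>, of i] by simp
      moreover have "i < n\<^sup>2"
        using that assms(5) by auto
      ultimately show ?thesis
        using y_nth x_givens that by simp
    qed
    ultimately show "y \<in> sudoku_solutions n \<pi>\<^sub>1 \<pi>\<^sub>2 \<pi>\<^sub>3 I g"
      unfolding sudoku_solutions_iff[OF perms] using y y_nth inv_lt x(2) by auto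
  qed
qed

end
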